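(* Let $\mathbf{X}\sim\mathbb{P}_{\beta,\mathbf{Q},\boldsymbol{\mu}}$ where $\min_{i,j}\beta\mathbf{Q}_{ij}\ge0$. Let $\mathcal{C}_n$ be a class of subsets of $[n]$ of size $s$, and suppose there are a constant $C_l>0$ and a sub-collection $\mathcal{C}_n'\subseteq\mathcal{C}_n$ of pairwise disjoint sets with $\log|\mathcal{C}_n'|\ge C_l\log n$. Consider testing $H_0:\boldsymbol{\mu}=\mathbf{0}$ against $H_1:\boldsymbol{\mu}\in\Xi(\mathcal{C}_n,s,A)$. Then there exists $c>0$ such that whenever $s\le c\log n$, the following hold. (I) If $$\lim_{n\to\infty}\sup_{S_1\neq S_2\in\mathcal{C}_n'}\Big|\frac{\mathbb{P}_{\beta,\mathbf{Q},\mathbf{0}}(\mathbf{X}_{S_1}=\mathbf{1},\mathbf{X}_{S_2}=\mathbf{1})}{\mathbb{P}_{\beta,\mathbf{Q},\mathbf{0}}(\mathbf{X}_{S_1}=\mathbf{1})\,\mathbb{P}_{\beta,\mathbf{Q},\mathbf{0}}(\mathbf{X}_{S_2}=\mathbf{1})}-1\Big|=0,$$ then all tests are asymptotically powerless irrespective of $A$. (II) If there exist an increasing set $\Omega_n\subseteq\{-1,+1\}^n$ and a constant $\kappa>0$ such that $\liminf_{n\to\infty}\mathbb{P}_{\beta,\mathbf{Q},\mathbf{0}}(\Omega_n)>\kappa$ and $$\lim_{n\to\infty}\sup_{S_1\neq S_2\in\mathcal{C}_n'}\Big|\frac{\mathbb{P}_{\beta,\mathbf{Q},\mathbf{0}}(\mathbf{X}_{S_1}=\mathbf{1},\mathbf{X}_{S_2}=\mathbf{1}|\Omega_n)}{\mathbb{P}_{\beta,\mathbf{Q},\mathbf{0}}(\mathbf{X}_{S_1}=\mathbf{1}|\Omega_n)\,\mathbb{P}_{\beta,\mathbf{Q},\mathbf{0}}(\mathbf{X}_{S_2}=\mathbf{1}|\Omega_n)}-1\Big|=0,$$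 then no test is asymptotically powerful irrespective of $A$.
   Context: Ising model: for a symmetric real $n\times n$ matrix $\mathbf{Q}=\mathbf{Q}_n$ with zero diagonal, $\beta\in\mathbb{R}$ and $\boldsymbol{\mu}\in\mathbb{R}^n$, $\mathbb{P}_{\beta,\mathbf{Q},\boldsymbol{\mu}}$ is the law on $\{\pm1\}^n$ with $\mathbb{P}_{\beta,\mathbf{Q},\boldsymbol{\mu}}(\mathbf{X}=\mathbf{x})=\frac{1}{Z_n(\beta,\mathbf{Q},\boldsymbol{\mu})}\exp\big(\frac{\beta}{2}\mathbf{x}^\top\mathbf{Q}\mathbf{x}+\boldsymbol{\mu}^\top\mathbf{x}\big)$. $\mathbf{X}_S=(X_i)_{i\in S}$, and $\mathbf{X}_S=\mathbf{1}$ means $X_i=1$ for all $i\in S$; conditioning on $\Omega_n$ means conditioning on $\mathbf{X}\in\Omega_n$. A set $\Omega\subseteq\{-1,+1\}^n$ is increasing if $\mathbf{x}\in\Omega$ and $\mathbf{y}\ge\mathbf{x}$ coordinate-wise imply $\mathbf{y}\in\Omega$. Testing problem: $s=s_n\in[n]=\{1,\dots,n\}$; $A=A_n>0$; every set in $\mathcal{C}_n$ has size $s$; $\Xi(\mathcal{C}_n,s,A)=\{\boldsymbol{\mu}\in\mathbb{R}_+^n:\ \mathrm{supp}(\boldsymbol{\mu})\in\mathcal{C}_n,\ \min_{i\in\mathrm{supp}(\boldsymbol{\mu})}\mu_i\ge A\}$, with $\mathrm{supp}(\boldsymbol{\mu})=\{i:\mu_i\neq0\}$. A test is a function $T:\{\pm1\}^n\to\{0,1\}$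 ($1$ means reject $H_0$), with $\mathrm{Risk}(T)=\mathbb{P}_{\beta,\mathbf{Q},\mathbf{0}}(T(\mathbf{X})=1)+\sup_{\boldsymbol{\mu}\in\Xi(\mathcal{C}_n,s,A)}\mathbb{P}_{\beta,\mathbf{Q},\boldsymbol{\mu}}(T(\mathbf{X})=0)$. A sequence of tests $T_n$ is asymptotically powerful if $\limsup_n\mathrm{Risk}(T_n)=0$ and asymptotically powerless if $\liminf_n\mathrm{Risk}(T_n)=1$. "All tests are asymptotically powerless" means every sequence of tests is asymptotically powerless; "no test is asymptotically powerful" means no sequence of tests is asymptotically powerful. "Irrespective of $A$" means for every choice of the sequence $A=A_n>0$. The constant $c$ does not depend on $n,s,A$; it may depend on the sequence $(\beta,\mathbf{Q})$ and on $C_l$.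
   Formalization: "Asymptotically powerless" is taken as liminf Risk ≥ 1 instead of = 1, since the risk of a bad test can exceed 1 (Q = 0, singletons, rejecting iff X_1 = -1 has risk 3/2); for tests with risk at most 1 the two agree. *)

theory Defs
  imports "HOL-Probability.Probability"
begin

text \<open>
  Vectors in \<open>\<real>\<^sup>n\<close> are functions \<open>nat \<Rightarrow> real\<close> and real \<open>n \<times> n\<close> matrices are functions
  \<open>nat \<Rightarrow> nat \<Rightarrow> real\<close>; only their values at indices in \<open>{1..n}\<close> are ever used.
  Spin configurations are extensional outside \<open>{1..n}\<close>, so that \<open>spins n\<close> has exactly \<open>2 ^ n\<close> elements.
\<close>

definition spins :: "nat \<Rightarrow> (nat \<Rightarrow> real) set" where
  "spins n = {1..n} \<rightarrow>\<^sub>E {-1, 1}"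

definition ising_weight ::
  "nat \<Rightarrow> real \<Rightarrow> (nat \<Rightarrow> nat \<Rightarrow> real) \<Rightarrow> (nat \<Rightarrow> real) \<Rightarrow> (nat \<Rightarrow> real) \<Rightarrow> real" where
  "ising_weight n \<beta> Q \<mu> x =
     exp (\<beta> / 2 * (\<Sum>i\<in>{1..n}. \<Sum>j\<in>{1..n}. x i * Q i j * x j) + (\<Sum>i\<in>{1..n}. \<mu> i * x i))"

definition ising_Z :: "nat \<Rightarrow> real \<Rightarrow> (nat \<Rightarrow> nat \<Rightarrow> real) \<Rightarrow> (nat \<Rightarrow> real) \<Rightarrow> real" where
  "ising_Z n \<beta> Q \<mu> = (\<Sum>x\<in>spins n. ising_weight n \<beta> Q \<mu> x)"

definition ising :: "nat \<Rightarrow> real \<Rightarrow> (nat \<Rightarrow> nat \<Rightarrow> real) \<Rightarrow> (nat \<Rightarrow> real) \<Rightarrow> (nat \<Rightarrow> real) pmf" where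
  "ising n \<beta> Q \<mu> =
     embed_pmf (\<lambda>x. if x \<in> spins n then ising_weight n \<beta> Q \<mu> x / ising_Z n \<beta> Q \<mu> else 0)"

lemma finite_spins: "finite (spins n)"
  by (simp add: spins_def finite_PiE)

lemma spins_nonempty: "spins n \<noteq> {}"
  by (simp add: spins_def PiE_eq_empty_iff)

lemma ising_Z_pos: "ising_Z n \<beta> Q \<mu> > 0"
  unfolding ising_Z_def
  by (rule sum_pos) (simp_all add: finite_spins spins_nonempty ising_weight_def)

lemma pmf_ising:
  "pmf (ising n \<beta> Q \<mu>) x =
     (if x \<in> spins n then ising_weight n \<beta> Q \<mu> x / ising_Z n \<beta> Q \<mu> else 0)"
  unfolding ising_def
proof (rule pmf_embed_pmf)
  let ?f = "\<lambda>x. if x \<in> spins n then ising_weight n \<beta> Q \<mu> x / ising_Z n \<beta> Q \<mu> else 0"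
  show nonneg: "0 \<le> ?f y" for y
    using ising_Z_pos[of n \<beta> Q \<mu>] by (simp add: ising_weight_def)
  have "(\<integral>\<^sup>+y. ennreal (?f y) \<partial>count_space UNIV) = (\<Sum>y\<in>spins n. ennreal (?f y))"
    by (rule nn_integral_count_space') (auto simp: finite_spins)
  also have "\<dots> = ennreal (\<Sum>y\<in>spins n. ?f y)"
    by (rule sum_ennreal) (rule nonneg)
  also have "(\<Sum>y\<in>spins n. ?f y) = 1"
    using ising_Z_pos[of n \<beta> Q \<mu>] by (simp add: sum_divide_distrib[symmetric] ising_Z_def)
  finally show "(\<integral>\<^sup>+y. ennreal (?f y) \<partial>count_space UNIV) = 1"
    by simp
qed

definition all_ones :: "nat set \<Rightarrow> (nat \<Rightarrow> real) \<Rightarrow> bool" where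
  "all_ones S x \<longleftrightarrow> (\<forall>i\<in>S. x i = 1)"

definition increasing_spins :: "nat \<Rightarrow> (nat \<Rightarrow> real) set \<Rightarrow> bool" where
  "increasing_spins n \<Omega> \<longleftrightarrow>
     \<Omega> \<subseteq> spins n \<and> (\<forall>x\<in>\<Omega>. \<forall>y\<in>spins n. (\<forall>i\<in>{1..n}. x i \<le> y i) \<longrightarrow> y \<in> \<Omega>)"

definition supp :: "nat \<Rightarrow> (nat \<Rightarrow> real) \<Rightarrow> nat set" where
  "supp n \<mu> = {i\<in>{1..n}. \<mu> i \<noteq> 0}"

definition Xi :: "nat \<Rightarrow> nat set set \<Rightarrow> real \<Rightarrow> (nat \<Rightarrow> real) set" where
  "Xi n \<C> A = {\<mu>. (\<forall>i\<in>{1..n}. 0 \<le> \<mu> i) \<and> supp n \<mu> \<in> \<C> \<and> (\<forall>i\<in>supp n \<mu>. A \<le> \<mu> i)}"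

definition is_test :: "nat \<Rightarrow> ((nat \<Rightarrow> real) \<Rightarrow> nat) \<Rightarrow> bool" where
  "is_test n T \<longleftrightarrow> T \<in> spins n \<rightarrow> {0, 1}"

definition risk ::
  "nat \<Rightarrow> real \<Rightarrow> (nat \<Rightarrow> nat \<Rightarrow> real) \<Rightarrow> nat set set \<Rightarrow> real \<Rightarrow> ((nat \<Rightarrow> real) \<Rightarrow> nat) \<Rightarrow> real" where
  "risk n \<beta> Q \<C> A T =
     \<P>(x in ising n \<beta> Q (\<lambda>_. 0). T x = 1) + (SUP \<mu>\<in>Xi n \<C> A. \<P>(x in ising n \<beta> Q \<mu>. T x = 0))"

definition asymp_powerful ::
  "(nat \<Rightarrow> real) \<Rightarrow> (nat \<Rightarrow> nat \<Rightarrow> nat \<Rightarrow> real) \<Rightarrow> (nat \<Rightarrow> nat set set) \<Rightarrow> (nat \<Rightarrow> real) \<Rightarrow>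
     (nat \<Rightarrow> (nat \<Rightarrow> real) \<Rightarrow> nat) \<Rightarrow> bool" where
  "asymp_powerful \<beta> Q \<C> A T \<longleftrightarrow>
     limsup (\<lambda>n. ereal (risk n (\<beta> n) (Q n) (\<C> n) (A n) (T n))) = 0"

text \<open>
  The usual wording is \<open>liminf = 1\<close>, which tacitly ignores tests that are worse than the constant
  ones (whose risk is \<open>1\<close>): the supremum in \<^const>\<open>risk\<close> lets the risk of a bad test exceed \<open>1\<close>.
  For instance, let \<open>Q = 0\<close>, let \<open>\<C>\<close> consist of all singletons and let \<open>T\<close> reject iff \<open>x 1 = -1\<close>;
  the risk is then \<open>1 / 2 + 1\<close>. Hence \<open>1\<close> is a lower bound here.
\<close>

definition asymp_powerless ::
  "(nat \<Rightarrow> real) \<Rightarrow> (nat \<Rightarrow> nat \<Rightarrow> nat \<Rightarrow> real) \<Rightarrow> (nat \<Rightarrow> nat set set) \<Rightarrow> (nat \<Rightarrow> real) \<Rightarrow>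
     (nat \<Rightarrow> (nat \<Rightarrow> real) \<Rightarrow> nat) \<Rightarrow> bool" where
  "asymp_powerless \<beta> Q \<C> A T \<longleftrightarrow>
     liminf (\<lambda>n. ereal (risk n (\<beta> n) (Q n) (\<C> n) (A n) (T n))) \<ge> 1"

end

theory Submission
  imports Defs
begin

text \<open>
  The class of alternatives contains arbitrarily strong fields: as \<open>B \<rightarrow> \<infinity>\<close>, the model with field
  \<open>B\<close> on \<open>S\<close> converges to the null model conditioned on \<open>X\<^sub>S = 1\<close>. Hence, whatever \<open>A\<close> is, the risk of \<open>T\<close>
  is at least \<open>P(T = 1) + P(T = 0 | X\<^sub>S = 1)\<close> for every \<open>S\<close>. Let \<open>p = P(\<Omega>)\<close> for an increasing \<open>\<Omega>\<close>.
  By the FKG inequality \<open>P(\<Omega> | X\<^sub>S = 1) \<ge> p\<close>, so the risk is at least \<open>p\<close> times the same expression for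
  \<open>q = P( \<cdot> | \<Omega>)\<close>. Averaging over \<open>S \<in> \<C>'\<close>, the likelihood ratio
  \<open>L = |\<C>'|\<^sup>-\<^sup>1 \<Sum>\<^sub>S 1(X\<^sub>S = 1) / q(X\<^sub>S = 1)\<close> has mean \<open>1\<close> and variance at most \<open>\<epsilon> + 2\<^sup>s / |\<C>'|\<close>, where \<open>\<epsilon>\<close> bounds
  the pair correlations and \<open>q(X\<^sub>S = 1) \<ge> P(X\<^sub>S = 1) \<ge> 2\<^sup>-\<^sup>s\<close> follows from FKG and spin flip symmetry. The risk is thus
  at least \<open>p (1 - sqrt(\<epsilon> + 2\<^sup>s / |\<C>'|))\<close>; part (I) is the case where \<open>\<Omega>\<close> is the whole space.
\<close>

section \<open>The four functions inequality on a two-valued cube\<close>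

text \<open>The case of a single coordinate. Indices stand for the low and high value;
  \<open>c\<close> is read at the maximum and \<open>d\<close> at the minimum, so both mixed
  products on the left are compared with the same \<open>c1 * d0\<close>. Bounding each by it
  separately would be too weak; their sum has to be bounded by
  \<open>c1 * d0 + c0 * d1\<close>.\<close>

lemma four_functions_two_point:
  fixes a0 a1 b0 b1 c0 c1 d0 d1 :: real
  assumes nonneg: "0 \<le> a0" "0 \<le> a1" "0 \<le> b0" "0 \<le> b1" "0 \<le> c0" "0 \<le> c1" "0 \<le> d0" "0 \<le> d1"
    and 00: "a0 * b0 \<le> c0 * d0" and 01: "a0 * b1 \<le> c1 * d0"
    and 10: "a1 * b0 \<le> c1 * d0" and 11: "a1 * b1 \<le> c1 * d1"
  shows "(a0 + a1) * (b0 + b1) \<le> (c0 + c1) * (d0 + d1)"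
proof -
  have "a0 * b1 + a1 * b0 \<le> c1 * d0 + c0 * d1"
  proof (cases "c1 * d0 = 0")
    case True
    then show ?thesis using 01 10 nonneg by (smt (verit) mult_nonneg_nonneg)
  next
    case False
    then have pos: "c1 * d0 > 0" using nonneg by (simp add: less_le)
    have "(a0 * b0) * (a1 * b1) \<le> (c0 * d0) * (c1 * d1)"
      by (intro mult_mono 00 11) (use nonneg in auto)
    \<comment> \<open>With \<open>m = c1 * d0\<close> and mixed products \<open>u\<close>,
      \<open>v\<close>, expanding gives \<open>m * (u + v) \<le> m * m + u * v\<close>, and the
      previous line bounds \<open>u * v\<close> by \<open>m * (c0 * d1)\<close>.\<close>
    moreover have "0 \<le> (c1 * d0 - a0 * b1) * (c1 * d0 - a1 * b0)"
      using 01 10 by simp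
    ultimately have "(c1 * d0) * (a0 * b1 + a1 * b0) \<le> (c1 * d0) * (c1 * d0 + c0 * d1)"
      by (simp add: algebra_simps)
    then show ?thesis using pos by (simp only: mult_le_cancel_left_pos)
  qed
  then show ?thesis using 00 11 by (simp add: algebra_simps)
qed

lemma sum_PiE_insert:
  assumes "i \<notin> I"
  shows "(\<Sum>x\<in>insert i I \<rightarrow>\<^sub>E V. f x) = (\<Sum>x\<in>I \<rightarrow>\<^sub>E V. \<Sum>v\<in>V. f (x(i := v)))"
proof -
  have "(\<Sum>x\<in>insert i I \<rightarrow>\<^sub>E V. f x) = (\<Sum>(v, x)\<in>V \<times> (I \<rightarrow>\<^sub>E V). f (x(i := v)))"
    unfolding PiE_insert_eq
    by (subst sum.reindex[OF inj_combinator[OF assms]]) (simp add: case_prod_beta)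
  also have "\<dots> = (\<Sum>x\<in>I \<rightarrow>\<^sub>E V. \<Sum>v\<in>V. f (x(i := v)))"
    by (simp add: sum.cartesian_product[symmetric] sum.swap[of _ V])
  finally show ?thesis .
qed

text \<open>The Ahlswede-Daykin inequality, by induction on the coordinates: summing out one
  coordinate preserves the hypothesis, by the two-point case. Nonnegativity is assumed everywhere,
  not only on the cube, so that it passes at once to the partially summed functions.\<close>

lemma four_functions:
  fixes f1 f2 f3 f4 :: "('i \<Rightarrow> 'v::linorder) \<Rightarrow> real"
  assumes "finite I" and "a < b"
    and "\<And>x. 0 \<le> f1 x" "\<And>x. 0 \<le> f2 x" "\<And>x. 0 \<le> f3 x" "\<And>x. 0 \<le> f4 x"
    and "\<And>x y. x \<in> I \<rightarrow>\<^sub>E {a, b} \<Longrightarrow> y \<in> I \<rightarrow>\<^sub>E {a, b} \<Longrightarrow>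
      f1 x * f2 y \<le> f3 (\<lambda>i. max (x i) (y i)) * f4 (\<lambda>i. min (x i) (y i))"
  shows "(\<Sum>x\<in>I \<rightarrow>\<^sub>E {a, b}. f1 x) * (\<Sum>x\<in>I \<rightarrow>\<^sub>E {a, b}. f2 x)
    \<le> (\<Sum>x\<in>I \<rightarrow>\<^sub>E {a, b}. f3 x) * (\<Sum>x\<in>I \<rightarrow>\<^sub>E {a, b}. f4 x)"
  using assms(1,3-)
proof (induction I arbitrary: f1 f2 f3 f4 rule: finite_induct)
  case empty
  then show ?case by (auto simp: max_def min_def dest: meta_spec[of _ "\<lambda>_. undefined"])
next
  case (insert i I)
  define g where "g f x = f (x(i := a)) + f (x(i := b))" for f :: "('i \<Rightarrow> 'v) \<Rightarrow> real" and x
  have sum_eq: "(\<Sum>x\<in>insert i I \<rightarrow>\<^sub>E {a, b}. f x) = (\<Sum>x\<in>I \<rightarrow>\<^sub>E {a, b}. g f x)" for f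
    using \<open>a < b\<close> by (simp add: sum_PiE_insert[OF insert.hyps(2)] g_def)
  note nonneg = insert.prems(1-4)
  have "g f1 x * g f2 y \<le> g f3 (\<lambda>i. max (x i) (y i)) * g f4 (\<lambda>i. min (x i) (y i))"
    if "x \<in> I \<rightarrow>\<^sub>E {a, b}" "y \<in> I \<rightarrow>\<^sub>E {a, b}" for x y
  proof -
    let ?u = "\<lambda>i. max (x i) (y i)" and ?v = "\<lambda>i. min (x i) (y i)"
    have upd: "f1 (x(i := u)) * f2 (y(i := v))
      \<le> f3 ((\<lambda>i. max (x i) (y i))(i := max u v)) * f4 ((\<lambda>i. min (x i) (y i))(i := min u v))"
      if "u \<in> {a, b}" "v \<in> {a, b}" for u v
    proof -
      have "f1 (x(i := u)) * f2 (y(i := v))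
        \<le> f3 (\<lambda>j. max ((x(i := u)) j) ((y(i := v)) j)) * f4 (\<lambda>j. min ((x(i := u)) j) ((y(i := v)) j))"
        using \<open>x \<in> _\<close> \<open>y \<in> _\<close> that by (intro insert.prems(5)) (auto simp: PiE_iff extensional_def)
      also have "(\<lambda>j. max ((x(i := u)) j) ((y(i := v)) j)) = (\<lambda>i. max (x i) (y i))(i := max u v)"
        by auto
      also have "(\<lambda>j. min ((x(i := u)) j) ((y(i := v)) j)) = (\<lambda>i. min (x i) (y i))(i := min u v)"
        by auto
      finally show ?thesis .
    qed
    have "max a b = b" "max b a = b" "min a b = a" "min b a = a"
      using \<open>a < b\<close> by simp_all
    \<comment> \<open>The two assignments with different values have the same maximum
      \<open>b\<close> and the same minimum \<open>a\<close>; hence the repeated right-hand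
      side.\<close>
    then have "f1 (x(i := a)) * f2 (y(i := a)) \<le> f3 (?u(i := a)) * f4 (?v(i := a))"
      "f1 (x(i := a)) * f2 (y(i := b)) \<le> f3 (?u(i := b)) * f4 (?v(i := a))"
      "f1 (x(i := b)) * f2 (y(i := a)) \<le> f3 (?u(i := b)) * f4 (?v(i := a))"
      "f1 (x(i := b)) * f2 (y(i := b)) \<le> f3 (?u(i := b)) * f4 (?v(i := b))"
      using upd[of a a] upd[of a b] upd[of b a] upd[of b b] by simp_all
    then show ?thesis
      unfolding g_def by (intro four_functions_two_point nonneg)
  qed
  then show ?case
    unfolding sum_eq by (intro insert.IH) (simp_all add: g_def nonneg)
qed

section \<open>Ising probabilities and the FKG inequality for nonnegative couplings\<close>

lemma set_pmf_ising: "set_pmf (ising n \<beta> Q \<mu>) = spins n"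
  using ising_Z_pos[of n \<beta> Q \<mu>] by (auto simp: set_pmf_iff pmf_ising ising_weight_def split: if_splits)

lemma measure_ising:
  "measure_pmf.prob (ising n \<beta> Q \<mu>) E = (\<Sum>x\<in>spins n \<inter> E. ising_weight n \<beta> Q \<mu> x) / ising_Z n \<beta> Q \<mu>"
proof -
  have "measure_pmf.prob (ising n \<beta> Q \<mu>) E = measure_pmf.prob (ising n \<beta> Q \<mu>) (spins n \<inter> E)"
    by (intro measure_pmf.finite_measure_eq_AE) (auto simp: AE_measure_pmf_iff set_pmf_ising)
  then show ?thesis
    by (simp add: measure_measure_pmf_finite finite_spins pmf_ising sum_divide_distrib)
qed

lemma prob_spins: "measure_pmf.prob (ising n \<beta> Q \<mu>) (spins n) = 1"
  using ising_Z_pos[of n \<beta> Q \<mu>] by (simp add: measure_ising ising_Z_def)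

lemma ising_weight_pos: "0 < ising_weight n \<beta> Q \<mu> x"
  by (simp add: ising_weight_def)

text \<open>Equality holds unless the two pairs are ordered oppositely; then the gap is a product of
  two differences of equal sign.\<close>

lemma mult_le_max_min:
  fixes a b c d :: real
  shows "a * b + c * d \<le> max a c * max b d + min a c * min b d"
proof -
  consider "a \<le> c" "b \<le> d" | "a \<le> c" "d \<le> b" | "c \<le> a" "b \<le> d" | "c \<le> a" "d \<le> b" by linarith
  then show ?thesis
  proof cases
    case 2
    have "0 \<le> (c - a) * (b - d)" using 2 by simp
    with 2 show ?thesis by (simp add: max_def min_def algebra_simps)
  next
    case 3
    have "0 \<le> (a - c) * (d - b)" using 3 by simp
    with 3 show ?thesis by (simp add: max_def min_def algebra_simps)
  qed (simp_all add: max_def min_def algebra_simps)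
qed

text \<open>The quadratic part of the exponent is a nonnegative combination of the supermodular
  functions \<open>x i * x j\<close>, and the field term is additive under maximum and minimum, so
  any \<open>\<mu>\<close> is allowed.\<close>

lemma ising_weight_log_supermodular:
  assumes "\<And>i j. i \<in> {1..n} \<Longrightarrow> j \<in> {1..n} \<Longrightarrow> 0 \<le> \<beta> * Q i j"
  shows "ising_weight n \<beta> Q \<mu> x * ising_weight n \<beta> Q \<mu> y
    \<le> ising_weight n \<beta> Q \<mu> (\<lambda>i. max (x i) (y i)) * ising_weight n \<beta> Q \<mu> (\<lambda>i. min (x i) (y i))"
proof -
  let ?u = "\<lambda>i. max (x i) (y i)" and ?v = "\<lambda>i. min (x i) (y i)"
  have quad: "\<beta> / 2 * (\<Sum>i\<in>{1..n}. \<Sum>j\<in>{1..n}. z i * Q i j * z j)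
      = (\<Sum>i\<in>{1..n}. \<Sum>j\<in>{1..n}. \<beta> * Q i j / 2 * (z i * z j))" for z
    by (simp add: sum_distrib_left mult_ac)
  have "(\<beta> * Q i j / 2) * (x i * x j) + (\<beta> * Q i j / 2) * (y i * y j)
    \<le> (\<beta> * Q i j / 2) * (?u i * ?u j) + (\<beta> * Q i j / 2) * (?v i * ?v j)"
    if "i \<in> {1..n}" "j \<in> {1..n}" for i j
    unfolding distrib_left[symmetric]
    using assms[OF that] by (intro mult_left_mono mult_le_max_min) simp
  then have "(\<Sum>i\<in>{1..n}. \<Sum>j\<in>{1..n}. \<beta> * Q i j / 2 * (x i * x j))
      + (\<Sum>i\<in>{1..n}. \<Sum>j\<in>{1..n}. \<beta> * Q i j / 2 * (y i * y j))
    \<le> (\<Sum>i\<in>{1..n}. \<Sum>j\<in>{1..n}. \<beta> * Q i j / 2 * (?u i * ?u j))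
      + (\<Sum>i\<in>{1..n}. \<Sum>j\<in>{1..n}. \<beta> * Q i j / 2 * (?v i * ?v j))"
    unfolding sum.distrib[symmetric] by (intro sum_mono)
  moreover have "(\<Sum>i\<in>{1..n}. \<mu> i * x i) + (\<Sum>i\<in>{1..n}. \<mu> i * y i)
    = (\<Sum>i\<in>{1..n}. \<mu> i * ?u i) + (\<Sum>i\<in>{1..n}. \<mu> i * ?v i)"
    unfolding sum.distrib[symmetric] by (intro sum.cong) (auto simp: max_def min_def)
  ultimately show ?thesis
    unfolding ising_weight_def quad exp_add[symmetric] by simp
qed

text \<open>The four functions are the weight restricted to \<open>A\<close>, to \<open>B\<close>,
  to \<open>A \<inter> B\<close>, and unrestricted. The factor over \<open>UNIV\<close> is the
  partition function, which turns the inequality between sums into one between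
  probabilities.\<close>

lemma ising_fkg:
  assumes ferro: "\<And>i j. i \<in> {1..n} \<Longrightarrow> j \<in> {1..n} \<Longrightarrow> 0 \<le> \<beta> * Q i j"
    and A: "increasing_spins n A" and B: "increasing_spins n B"
  shows "measure_pmf.prob (ising n \<beta> Q \<mu>) A * measure_pmf.prob (ising n \<beta> Q \<mu>) B
    \<le> measure_pmf.prob (ising n \<beta> Q \<mu>) (A \<inter> B)"
proof -
  define w where "w = ising_weight n \<beta> Q \<mu>"
  have sum_eq: "(\<Sum>x\<in>spins n \<inter> E. w x) = (\<Sum>x\<in>{1..n} \<rightarrow>\<^sub>E {- 1, 1}. w x * indicator E x)" for E
    using finite_spins[of n] by (simp add: sum.inter_restrict indicator_def spins_def if_distrib cong: if_cong)
  have "(\<Sum>x\<in>spins n \<inter> A. w x) * (\<Sum>x\<in>spins n \<inter> B. w x)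
    \<le> (\<Sum>x\<in>spins n \<inter> (A \<inter> B). w x) * (\<Sum>x\<in>spins n \<inter> UNIV. w x)"
    unfolding sum_eq
  proof (rule four_functions)
    fix x y :: "nat \<Rightarrow> real" assume xy: "x \<in> {1..n} \<rightarrow>\<^sub>E {- 1, 1::real}" "y \<in> {1..n} \<rightarrow>\<^sub>E {- 1, 1}"
    then have "(\<lambda>i. max (x i) (y i)) \<in> spins n"
      by (auto simp: spins_def PiE_iff extensional_def max_def)
    then have "x \<in> A \<Longrightarrow> (\<lambda>i. max (x i) (y i)) \<in> A" "y \<in> B \<Longrightarrow> (\<lambda>i. max (x i) (y i)) \<in> B"
      using A B unfolding increasing_spins_def by (meson max.cobounded1 max.cobounded2)+
    \<comment> \<open>If \<open>x\<close> is in \<open>A\<close> and \<open>y\<close> in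
      \<open>B\<close>, their maximum dominates both and so lies in \<open>A \<inter> B\<close>: the
      left side is nonzero only where the indicators on the right equal 1.\<close>
    then show "w x * indicator A x * (w y * indicator B y)
      \<le> w (\<lambda>i. max (x i) (y i)) * indicator (A \<inter> B) (\<lambda>i. max (x i) (y i)) *
        (w (\<lambda>i. min (x i) (y i)) * indicator UNIV (\<lambda>i. min (x i) (y i)))"
      using ising_weight_log_supermodular[of n \<beta> Q \<mu> x y, OF ferro]
      by (auto simp: indicator_def w_def less_imp_le[OF ising_weight_pos])
  qed (simp_all add: w_def less_imp_le[OF ising_weight_pos])
  then show ?thesis
    using ising_Z_pos[of n \<beta> Q \<mu>]
    by (simp add: measure_ising w_def[symmetric] ising_Z_def field_simps)
qed

section \<open>Spin flip symmetry and all-ones events under the null model\<close>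

lemma ising_weight_uminus: "ising_weight n \<beta> Q (\<lambda>_. 0) (\<lambda>i\<in>{1..n}. - x i) = ising_weight n \<beta> Q (\<lambda>_. 0) x"
  by (simp add: ising_weight_def)

text \<open>Without a field the global spin flip preserves weights, and it exchanges the two values
  of spin \<open>i\<close>.\<close>

lemma prob_spin_eq_one:
  assumes i: "i \<in> {1..n}"
  shows "measure_pmf.prob (ising n \<beta> Q (\<lambda>_. 0)) {x\<in>spins n. x i = 1} = 1 / 2"
proof -
  define w where "w = ising_weight n \<beta> Q (\<lambda>_. 0)"
  let ?S = "\<lambda>v. {x\<in>spins n. x i = v}"
  have "(\<Sum>x\<in>?S (-1). w x) = (\<Sum>x\<in>?S 1. w x)"
    by (rule sum.reindex_bij_witness[where i = "\<lambda>x. \<lambda>i\<in>{1..n}. - x i" and j = "\<lambda>x. \<lambda>i\<in>{1..n}. - x i"])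
      (use i in \<open>auto simp: spins_def w_def ising_weight_uminus[simplified] PiE_iff extensional_def fun_eq_iff\<close>)
  moreover have "ising_Z n \<beta> Q (\<lambda>_. 0) = (\<Sum>x\<in>?S (-1). w x) + (\<Sum>x\<in>?S 1. w x)"
    unfolding ising_Z_def w_def[symmetric]
    by (subst sum.union_disjoint[symmetric]) (use i in \<open>auto simp: spins_def intro!: sum.cong finite_PiE\<close>)
  moreover have "spins n \<inter> ?S 1 = ?S 1" by auto
  ultimately show ?thesis
    using ising_Z_pos[of n \<beta> Q "\<lambda>_. 0"] by (simp add: measure_ising w_def[symmetric])
qed

lemma increasing_all_ones:
  assumes "S \<subseteq> {1..n}"
  shows "increasing_spins n {x\<in>spins n. all_ones S x}"
  unfolding increasing_spins_def
proof (intro conjI ballI impI)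
  fix x y assume x: "x \<in> {x\<in>spins n. all_ones S x}" and y: "y \<in> spins n" and le: "\<forall>i\<in>{1..n}. x i \<le> y i"
  have "y i = 1" if "i \<in> S" for i
  proof -
    have "i \<in> {1..n}" using assms that by blast
    moreover from this have "y i \<in> {-1, 1}" using y unfolding spins_def by (rule PiE_mem[rotated])
    moreover have "x i = 1" using x that by (simp add: all_ones_def)
    ultimately show ?thesis using le by force
  qed
  then show "y \<in> {x\<in>spins n. all_ones S x}" using y by (simp add: all_ones_def)
qed auto

text \<open>Each further site costs at most a factor \<open>1 / 2\<close>: the events are
  increasing, so FKG bounds the intersection below by the product.\<close>

lemma prob_all_ones_ge:
  assumes ferro: "\<And>i j. i \<in> {1..n} \<Longrightarrow> j \<in> {1..n} \<Longrightarrow> 0 \<le> \<beta> * Q i j"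
    and "S \<subseteq> {1..n}"
  shows "(1 / 2) ^ card S \<le> measure_pmf.prob (ising n \<beta> Q (\<lambda>_. 0)) {x\<in>spins n. all_ones S x}"
proof -
  let ?P = "measure_pmf.prob (ising n \<beta> Q (\<lambda>_. 0))"
  have "finite S" using assms(2) finite_subset by blast
  then show ?thesis using assms(2)
  proof (induction S rule: finite_induct)
    case empty
    show ?case by (simp add: all_ones_def prob_spins)
  next
    case (insert i S)
    let ?E = "{x\<in>spins n. all_ones S x}" and ?F = "{x\<in>spins n. x i = 1}"
    have incr: "increasing_spins n ?E" "increasing_spins n ?F"
      using increasing_all_ones[of S n] increasing_all_ones[of "{i}" n] insert.prems
      by (simp_all add: all_ones_def)
    have "(1 / 2) ^ card (insert i S) = (1 / 2) ^ card S * (1 / 2 :: real)"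
      using insert.hyps by simp
    also have "\<dots> \<le> ?P {x\<in>spins n. all_ones S x} * ?P {x\<in>spins n. x i = 1}"
      using insert.IH insert.prems by (intro mult_mono) (simp_all add: prob_spin_eq_one)
    also have "\<dots> \<le> ?P ({x\<in>spins n. all_ones S x} \<inter> {x\<in>spins n. x i = 1})"
      using ferro incr by (rule ising_fkg)
    also have "{x\<in>spins n. all_ones S x} \<inter> {x\<in>spins n. x i = 1} = {x\<in>spins n. all_ones (insert i S) x}"
      by (auto simp: all_ones_def)
    finally show ?case .
  qed
qed

section \<open>The second moment method\<close>

text \<open>The averaged likelihood ratio \<open>L\<close> is close to 1 in mean square, so the
  average over \<open>i\<close> of the conditional probabilities of \<open>F\<close> is close to
  \<open>prob F\<close>; some \<open>i\<close> does at least as well as the average. Later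
  \<open>F\<close> is the acceptance region of a test.\<close>

lemma (in prob_space) second_moment_bound:
  assumes I: "finite I" "I \<noteq> {}"
    and [measurable]: "\<And>i. i \<in> I \<Longrightarrow> E i \<in> events" "F \<in> events"
    and \<delta>: "\<And>i. i \<in> I \<Longrightarrow> \<delta> \<le> prob (E i)" "0 < \<delta>" and "0 \<le> \<epsilon>"
    and pairs: "\<And>i j. i \<in> I \<Longrightarrow> j \<in> I \<Longrightarrow> i \<noteq> j \<Longrightarrow>
      \<bar>prob (E i \<inter> E j) / (prob (E i) * prob (E j)) - 1\<bar> \<le> \<epsilon>"
  shows "\<exists>i\<in>I. prob F - sqrt (\<epsilon> + 1 / (\<delta> * card I)) \<le> prob (E i \<inter> F) / prob (E i)"
proof (rule ccontr)
  define N where "N = real (card I)"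
  define L where "L x = (\<Sum>i\<in>I. indicator (E i) x / prob (E i)) / N" for x
  have N: "N > 0" using I by (simp add: N_def card_gt_0_iff)
  have pos: "0 < prob (E i)" if "i \<in> I" for i using \<delta> that by force
  have [measurable]: "L \<in> borel_measurable M" unfolding L_def by measurable
  have int: "integrable M (\<lambda>x. L x * indicator A x)" if "A \<in> events" for A
    unfolding L_def using that
    by (auto simp: sum_divide_distrib sum_distrib_right indicator_inter_arith[symmetric] emeasure_eq_measure
        intro!: Bochner_Integration.integrable_sum)
  have EL: "expectation (\<lambda>x. L x * indicator A x) = (\<Sum>i\<in>I. prob (E i \<inter> A) / prob (E i)) / N"
    if "A \<in> events" for A
  proof -
    have "expectation (\<lambda>x. L x * indicator A x)
      = expectation (\<lambda>x. (\<Sum>i\<in>I. indicator (E i \<inter> A) x / prob (E i)) / N)"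
      by (simp add: L_def sum_distrib_right indicator_inter_arith)
    also have "\<dots> = (\<Sum>i\<in>I. prob (E i \<inter> A) / prob (E i)) / N"
      using that by (simp add: emeasure_eq_measure Bochner_Integration.integral_sum)
    finally show ?thesis .
  qed
  have L1: "expectation L = 1"
  proof -
    have "expectation L = expectation (\<lambda>x. L x * indicator (space M) x)"
      by (intro Bochner_Integration.integral_cong) auto
    also have "\<dots> = (\<Sum>i\<in>I. 1) / N"
      unfolding EL[OF sets.top] using pos sets.Int_space_eq2
      by (intro arg_cong[of _ _ "\<lambda>x. x / N"] sum.cong refl) (force simp: assms)
    finally show ?thesis using N by (simp add: N_def)
  qed
  have L_sq: "(L x)\<^sup>2 = (\<Sum>i\<in>I. \<Sum>j\<in>I. indicator (E i \<inter> E j) x / (prob (E i) * prob (E j))) / N\<^sup>2" for x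
    by (simp add: L_def power2_eq_square sum_product indicator_inter_arith)
  have int2: "integrable M (\<lambda>x. (L x)\<^sup>2)"
    unfolding L_sq by (auto simp: emeasure_eq_measure intro!: Bochner_Integration.integrable_sum)
  have int1: "integrable M L"
    unfolding L_def by (auto simp: emeasure_eq_measure intro!: Bochner_Integration.integrable_sum)
  have "expectation (\<lambda>x. (L x)\<^sup>2) = (\<Sum>i\<in>I. \<Sum>j\<in>I. prob (E i \<inter> E j) / (prob (E i) * prob (E j))) / N\<^sup>2"
    unfolding L_sq by (simp add: emeasure_eq_measure Bochner_Integration.integral_sum)
  \<comment> \<open>Off the diagonal \<open>pairs\<close> applies; on it the summand is
    \<open>1 / prob (E i)\<close>. The diagonal has only \<open>N\<close> of the
    \<open>N\<^sup>2\<close> terms, so it contributes \<open>1 / (\<delta> * N)\<close>.\<close>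
  also have "\<dots> \<le> (\<Sum>i\<in>I. \<Sum>j\<in>I. 1 + \<epsilon> + (if i = j then 1 / \<delta> else 0)) / N\<^sup>2"
  proof (intro divide_right_mono sum_mono)
    fix i j assume ij: "i \<in> I" "j \<in> I"
    show "prob (E i \<inter> E j) / (prob (E i) * prob (E j)) \<le> 1 + \<epsilon> + (if i = j then 1 / \<delta> else 0)"
    proof (cases "i = j")
      case True
      have "1 / prob (E i) \<le> 1 / \<delta>"
        using \<delta> ij by (intro divide_left_mono) (auto intro: mult_pos_pos pos)
      then show ?thesis using True \<open>0 \<le> \<epsilon>\<close> pos[OF ij(1)] by simp
    next
      case False
      then show ?thesis using pairs[OF ij] by simp
    qed
  qed simp
  also have "\<dots> = 1 + \<epsilon> + 1 / (\<delta> * N)"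
    using N I \<delta>(2) by (simp add: sum.distrib sum.delta N_def[symmetric] power2_eq_square field_simps)
  finally have var: "variance L \<le> \<epsilon> + 1 / (\<delta> * N)"
    using variance_eq[OF int1 int2] by (simp add: L1)
  \<comment> \<open>The mean of \<open>Y\<close> is exactly the loss to be bounded, and by
    Cauchy-Schwarz its square is at most the variance of \<open>L\<close>.\<close>
  define Y where "Y x = (1 - L x) * indicator F x" for x
  have ind_int: "integrable M (indicator F :: 'a \<Rightarrow> real)" by (simp add: emeasure_eq_measure)
  have Y_int: "integrable M Y"
    unfolding Y_def using int[of F] ind_int by (simp add: left_diff_distrib)
  have Y_sq: "(Y x)\<^sup>2 = (1 - L x)\<^sup>2 * indicator F x" for x
    by (simp add: Y_def power_mult_distrib indicator_def)
  have sq_int: "integrable M (\<lambda>x. (1 - L x)\<^sup>2)"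
    by (simp add: power2_diff int1 int2)
  have Y2_int: "integrable M (\<lambda>x. (Y x)\<^sup>2)"
    unfolding Y_sq by (intro integrable_real_mult_indicator sq_int) auto
  have "(expectation Y)\<^sup>2 \<le> expectation (\<lambda>x. (Y x)\<^sup>2)"
    using variance_positive[of Y] by (simp add: variance_eq Y_int Y2_int)
  also have "\<dots> \<le> expectation (\<lambda>x. (1 - L x)\<^sup>2)"
    by (intro integral_mono Y2_int sq_int) (auto simp: Y_sq indicator_def)
  also have "\<dots> = variance L" by (simp add: L1 power2_commute)
  finally have "expectation Y \<le> sqrt (\<epsilon> + 1 / (\<delta> * N))"
    using var by (intro real_le_rsqrt) linarith
  moreover have "expectation Y = prob F - (\<Sum>i\<in>I. prob (E i \<inter> F) / prob (E i)) / N"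
    unfolding Y_def using int[of F] EL[of F] ind_int by (simp add: left_diff_distrib)
  ultimately have lb: "(prob F - sqrt (\<epsilon> + 1 / (\<delta> * N))) * N \<le> (\<Sum>i\<in>I. prob (E i \<inter> F) / prob (E i))"
    using N by (simp add: field_simps)
  \<comment> \<open>If every \<open>i\<close> fell short, so would the sum over \<open>I\<close>,
    against \<open>lb\<close>.\<close>
  assume "\<not> (\<exists>i\<in>I. prob F - sqrt (\<epsilon> + 1 / (\<delta> * card I)) \<le> prob (E i \<inter> F) / prob (E i))"
  then have "(\<Sum>i\<in>I. prob (E i \<inter> F) / prob (E i)) < (\<Sum>i\<in>I. prob F - sqrt (\<epsilon> + 1 / (\<delta> * N)))"
    using I by (intro sum_strict_mono) (auto simp: N_def not_le)
  with lb show False by (simp add: N_def mult.commute)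
qed

section \<open>Conditioning and the limit of strong fields\<close>

lemma measure_cond_pmf:
  assumes "set_pmf p \<inter> B \<noteq> {}"
  shows "measure_pmf.prob (cond_pmf p B) A = measure_pmf.prob p (A \<inter> B) / measure_pmf.prob p B"
proof -
  have "emeasure (cond_pmf p B) A = emeasure p (B \<inter> A) / emeasure p B"
    unfolding cond_pmf.rep_eq[OF assms] by (simp add: emeasure_uniform_measure)
  moreover have "measure_pmf.prob p B > 0"
    using assms by (auto simp: measure_pmf_posI)
  ultimately show ?thesis
    by (simp add: measure_pmf.emeasure_eq_measure divide_ennreal Int_commute)
qed

text \<open>A common factor \<open>exp (B * card S)\<close> cancels against the partition function.
  What remains of the field is a penalty that vanishes exactly on \<open>H\<close> and kills every
  other configuration as \<open>B\<close> grows; the sums are finite, so limits pass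
  through.\<close>

lemma ising_strong_field_limit:
  fixes n \<beta> Q S
  defines "P \<equiv> measure_pmf.prob (ising n \<beta> Q (\<lambda>_. 0))" and "H \<equiv> {x\<in>spins n. all_ones S x}"
  assumes S: "S \<subseteq> {1..n}"
  shows "((\<lambda>B. measure_pmf.prob (ising n \<beta> Q (\<lambda>i. if i \<in> S then B else 0)) E)
    \<longlongrightarrow> P (H \<inter> E) / P H) at_top"
proof -
  define w where "w = ising_weight n \<beta> Q (\<lambda>_. 0)"
  \<comment> \<open>On spin configurations this is twice the number of minus spins in
    \<open>S\<close>.\<close>
  define d where "d x = (\<Sum>i\<in>S. 1 - x i)" for x :: "nat \<Rightarrow> real"
  define g where "g E B = (\<Sum>x\<in>spins n \<inter> E. w x * exp (- (B * d x)))" for E B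
  have fin: "finite S" using S finite_subset by blast
  have weight: "ising_weight n \<beta> Q (\<lambda>i. if i \<in> S then B else 0) x
    = exp (B * card S) * (w x * exp (- (B * d x)))" for B x
  proof -
    have "(\<Sum>i\<in>{1..n}. (if i \<in> S then B else 0) * x i) = (\<Sum>i\<in>{1..n} \<inter> S. B * x i)"
      by (simp add: sum.inter_restrict if_distrib cong: if_cong) (intro sum.cong; simp)
    also have "\<dots> = B * card S - B * d x"
      using S by (simp add: Int_absorb1 d_def sum_subtractf sum_distrib_left[symmetric] algebra_simps)
    finally show ?thesis
      by (simp add: ising_weight_def w_def exp_add[symmetric] exp_diff exp_minus field_simps)
  qed
  have prob_eq: "measure_pmf.prob (ising n \<beta> Q (\<lambda>i. if i \<in> S then B else 0)) E = g E B / g UNIV B" for E B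
    by (simp add: measure_ising ising_Z_def weight g_def sum_distrib_left[symmetric])
  have term_lim: "((\<lambda>B. w x * exp (- (B * d x))) \<longlongrightarrow> w x * indicator H x) at_top" if x: "x \<in> spins n" for x
  proof -
    have le: "x i \<le> 1" if "i \<in> S" for i
    proof -
      have "i \<in> {1..n}" using S that by blast
      with x have "x i \<in> {- 1, 1}" unfolding spins_def by (rule PiE_mem)
      then show ?thesis by auto
    qed
    have "d x \<ge> 0" unfolding d_def by (intro sum_nonneg) (simp add: le)
    show ?thesis
    proof (cases "d x = 0")
      case True
      then have "x \<in> H"
        using x le fin by (auto simp: H_def d_def all_ones_def sum_nonneg_eq_0_iff)
      then show ?thesis using True by simp
    next
      case False
      then have "x \<notin> H" by (auto simp: H_def d_def all_ones_def intro: sum.neutral)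
      have "LIM B at_top. - (B * d x) :> at_bot"
        using False \<open>d x \<ge> 0\<close>
        by (auto simp: filterlim_uminus_at_top[symmetric] intro!: filterlim_at_top_mult_tendsto_pos tendsto_const filterlim_ident)
      then have "((\<lambda>B. exp (- (B * d x))) \<longlongrightarrow> 0) at_top"
        by (rule filterlim_compose[OF exp_at_bot])
      then show ?thesis using \<open>x \<notin> H\<close> by (auto intro!: tendsto_mult_right_zero)
    qed
  qed
  have g_lim: "(g E \<longlongrightarrow> (\<Sum>x\<in>spins n \<inter> E. w x * indicator H x)) at_top" for E
    unfolding g_def by (intro tendsto_sum term_lim) auto
  have lim_eq: "(\<Sum>x\<in>spins n \<inter> E. w x * indicator H x) = P (H \<inter> E) * ising_Z n \<beta> Q (\<lambda>_. 0)" for E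
  proof -
    have "(\<Sum>x\<in>spins n \<inter> E. w x * indicator H x) = (\<Sum>x\<in>(spins n \<inter> E) \<inter> H. w x)"
      using finite_spins[of n] by (simp add: sum.inter_restrict indicator_def if_distrib cong: if_cong)
    also have "spins n \<inter> E \<inter> H = spins n \<inter> (H \<inter> E)" by blast
    finally show ?thesis
      using ising_Z_pos[of n \<beta> Q "\<lambda>_. 0"] by (simp add: P_def measure_ising w_def)
  qed
  \<comment> \<open>The all-plus configuration gives \<open>H\<close> positive probability, so the
    limiting denominator is nonzero.\<close>
  have "(\<lambda>i\<in>{1..n}. 1) \<in> spins n \<inter> H"
    using S by (auto simp: H_def spins_def all_ones_def)
  then have "P H \<noteq> 0"
    unfolding P_def by (intro less_imp_neq[symmetric] measure_pmf_posI[of "\<lambda>i\<in>{1..n}. 1"])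
      (auto simp: set_pmf_ising)
  then show ?thesis
    unfolding prob_eq
    using tendsto_divide[OF g_lim[of E, unfolded lim_eq] g_lim[of UNIV, unfolded lim_eq]]
      ising_Z_pos[of n \<beta> Q "\<lambda>_. 0"] by simp
qed

text \<open>Every field \<open>B \<ge> A\<close> on \<open>S\<close> is an admissible alternative,
  so the supremum also dominates the limit as \<open>B\<close> grows. The resulting bound no longer
  contains \<open>A\<close>.\<close>

lemma risk_ge_all_ones:
  fixes n \<beta> Q S
  defines "P \<equiv> measure_pmf.prob (ising n \<beta> Q (\<lambda>_. 0))" and "H \<equiv> {x\<in>spins n. all_ones S x}"
  assumes S: "S \<in> \<C>" "S \<subseteq> {1..n}" and A: "0 < A"
  shows "P {x. T x = 1} + P (H \<inter> {x. T x = 0}) / P H \<le> risk n \<beta> Q \<C> A T"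
proof -
  let ?p = "\<lambda>\<mu>. measure_pmf.prob (ising n \<beta> Q \<mu>) {x. T x = 0}"
  \<comment> \<open>A supremum of reals is an upper bound only for a set bounded above.\<close>
  have bdd: "bdd_above (?p ` Xi n \<C> A)"
    by (intro bdd_aboveI[of _ 1]) auto
  have "?p (\<lambda>i. if i \<in> S then B else 0) \<le> (SUP \<mu>\<in>Xi n \<C> A. ?p \<mu>)" if "A \<le> B" for B
  proof (intro cSUP_upper bdd)
    have "supp n (\<lambda>i. if i \<in> S then B else 0) = S"
      using S A that by (auto simp: supp_def)
    then show "(\<lambda>i. if i \<in> S then B else 0) \<in> Xi n \<C> A"
      using S A that by (auto simp: Xi_def)
  qed
  then have "P (H \<inter> {x. T x = 0}) / P H \<le> (SUP \<mu>\<in>Xi n \<C> A. ?p \<mu>)"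
    unfolding P_def H_def
    by (intro tendsto_upperbound[OF ising_strong_field_limit[OF S(2)]])
      (auto intro: eventually_mono[OF eventually_ge_at_top[of A]])
  then show ?thesis by (simp add: risk_def P_def)
qed

section \<open>The risk bound for fixed \<open>n\<close>\<close>

text \<open>The second moment bound needs the conditional law as a probability space of its own; the
  pair condition is stated with conditional probabilities.\<close>

lemma cond_pmf_ising:
  assumes "\<Omega> \<subseteq> spins n" "\<Omega> \<noteq> {}"
  shows "measure_pmf.prob (cond_pmf (ising n \<beta> Q \<mu>) \<Omega>) {x\<in>spins n. R x} = \<P>(x in ising n \<beta> Q \<mu>. R x \<bar> x \<in> \<Omega>)"
proof -
  have "{x\<in>spins n. R x} \<inter> \<Omega> = {x. R x \<and> x \<in> \<Omega>}" using assms by auto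
  then show ?thesis
    using assms by (subst measure_cond_pmf) (auto simp: cond_prob_def set_pmf_ising)
qed

text \<open>The second moment bound is applied under \<open>q\<close>, with
  \<open>\<delta> = (1 / 2) ^ s\<close> and \<open>F\<close> the acceptance region; the result is
  carried back to the null law at the cost of a factor \<open>p\<close>.\<close>

lemma risk_lower_bound:
  assumes ferro: "\<And>i j. i \<in> {1..n} \<Longrightarrow> j \<in> {1..n} \<Longrightarrow> 0 \<le> \<beta> * Q i j"
    and \<Omega>: "increasing_spins n \<Omega>" "\<Omega> \<noteq> {}"
    and \<C>: "\<C>' \<subseteq> \<C>" "\<C>' \<noteq> {}" "\<And>S. S \<in> \<C>' \<Longrightarrow> S \<subseteq> {1..n} \<and> card S = s"
    and "0 < A" and T: "is_test n T" and "0 \<le> \<epsilon>"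
    and pairs: "\<And>S S'. S \<in> \<C>' \<Longrightarrow> S' \<in> \<C>' \<Longrightarrow> S \<noteq> S' \<Longrightarrow>
      \<bar>\<P>(x in ising n \<beta> Q (\<lambda>_. 0). all_ones S x \<and> all_ones S' x \<bar> x \<in> \<Omega>) /
        (\<P>(x in ising n \<beta> Q (\<lambda>_. 0). all_ones S x \<bar> x \<in> \<Omega>) *
         \<P>(x in ising n \<beta> Q (\<lambda>_. 0). all_ones S' x \<bar> x \<in> \<Omega>)) - 1\<bar> \<le> \<epsilon>"
  shows "\<P>(x in ising n \<beta> Q (\<lambda>_. 0). x \<in> \<Omega>) * (1 - sqrt (\<epsilon> + 2 ^ s / real (card \<C>'))) \<le> risk n \<beta> Q \<C> A T"
proof -
  define I where "I = ising n \<beta> Q (\<lambda>_. 0)"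
  define q where "q = cond_pmf I \<Omega>"
  define p where "p = measure_pmf.prob I \<Omega>"
  define H where "H S = {x\<in>spins n. all_ones S x}" for S
  have \<Omega>_sub: "\<Omega> \<subseteq> spins n" using \<Omega> by (simp add: increasing_spins_def)
  have set_I: "set_pmf I = spins n"
    by (simp add: I_def set_pmf_ising)
  have q_eq: "measure_pmf.prob q E = measure_pmf.prob I (E \<inter> \<Omega>) / p" for E
    unfolding q_def p_def using \<Omega> \<Omega>_sub set_I by (intro measure_cond_pmf) auto
  have p_pos: "p > 0"
    unfolding p_def using \<Omega> \<Omega>_sub set_I by (auto intro: measure_pmf_posI)
  have H_ge: "(1 / 2) ^ s \<le> measure_pmf.prob I (H S)" if "S \<in> \<C>'" for S
    using prob_all_ones_ge[of n \<beta> Q S] ferro \<C>(3)[OF that] by (auto simp: I_def H_def)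
  have H_pos: "0 < measure_pmf.prob I (H S)" if "S \<in> \<C>'" for S
    using H_ge[OF that] by (rule less_le_trans[rotated]) simp
  \<comment> \<open>Here monotonicity of \<open>\<Omega>\<close> enters: conditioning on it can only
    raise the probability of \<open>H S\<close>.\<close>
  have fkg: "measure_pmf.prob I (H S) * p \<le> measure_pmf.prob I (H S \<inter> \<Omega>)" if "S \<in> \<C>'" for S
    unfolding I_def p_def H_def using \<C>(3)[OF that]
    by (intro ising_fkg ferro increasing_all_ones \<Omega>) auto
  have q_H: "measure_pmf.prob I (H S) \<le> measure_pmf.prob q (H S)" if "S \<in> \<C>'" for S
    using fkg[OF that] p_pos by (simp add: q_eq field_simps)
  have "finite \<C>'"
    using \<C>(3) by (intro finite_subset[of \<C>' "Pow {1..n}"]) auto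
  moreover have "(1 / 2) ^ s \<le> measure_pmf.prob q (H S)" if "S \<in> \<C>'" for S
    using H_ge[OF that] q_H[OF that] by linarith
  moreover have "\<bar>measure_pmf.prob q (H S \<inter> H S') /
      (measure_pmf.prob q (H S) * measure_pmf.prob q (H S')) - 1\<bar> \<le> \<epsilon>"
    if "S \<in> \<C>'" "S' \<in> \<C>'" "S \<noteq> S'" for S S'
  proof -
    have "H S \<inter> H S' = {x\<in>spins n. all_ones S x \<and> all_ones S' x}" by (auto simp: H_def)
    then show ?thesis
      using pairs[OF that] by (simp add: q_def I_def H_def cond_pmf_ising \<Omega>_sub \<Omega>)
  qed
  ultimately obtain S where S: "S \<in> \<C>'" and
    *: "measure_pmf.prob q {x. T x = 0} - sqrt (\<epsilon> + 1 / ((1 / 2) ^ s * real (card \<C>')))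
      \<le> measure_pmf.prob q (H S \<inter> {x. T x = 0}) / measure_pmf.prob q (H S)"
    using measure_pmf.second_moment_bound[of \<C>' H q "{x. T x = 0}" "(1 / 2) ^ s" \<epsilon>] \<C> \<open>0 \<le> \<epsilon>\<close>
    by auto
  \<comment> \<open>\<open>q\<close> lives on \<open>\<Omega>\<close>, inside the spin
    configurations, where a test takes only the values 0 and 1.\<close>
  have "1 = measure_pmf.prob q (\<Omega> \<inter> ({x. T x = 0} \<union> {x. T x = 1}))"
  proof -
    have "\<Omega> \<inter> ({x. T x = 0} \<union> {x. T x = 1}) = \<Omega>"
      using T \<Omega>_sub by (auto simp: is_test_def)
    then show ?thesis using p_pos by (simp add: q_eq) (simp add: p_def)
  qed
  also have "\<dots> = measure_pmf.prob q {x. T x = 0} + measure_pmf.prob q {x. T x = 1}"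
  proof -
    have "measure_pmf.prob q (\<Omega> \<inter> ({x. T x = 0} \<union> {x. T x = 1}))
      = measure_pmf.prob q ({x. T x = 0} \<union> {x. T x = 1})"
      by (simp add: q_eq Int_commute)
    also have "\<dots> = measure_pmf.prob q {x. T x = 0} + measure_pmf.prob q {x. T x = 1}"
      by (intro measure_pmf.finite_measure_Union) auto
    finally show ?thesis .
  qed
  finally have "1 - sqrt (\<epsilon> + 2 ^ s / real (card \<C>'))
    \<le> measure_pmf.prob q {x. T x = 1} + measure_pmf.prob q (H S \<inter> {x. T x = 0}) / measure_pmf.prob q (H S)"
    using * by (simp add: power_one_over field_simps)
  then have "p * (1 - sqrt (\<epsilon> + 2 ^ s / real (card \<C>')))
    \<le> p * measure_pmf.prob q {x. T x = 1} + p * measure_pmf.prob q (H S \<inter> {x. T x = 0}) / measure_pmf.prob q (H S)"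
    using p_pos by (metis distrib_left mult_le_cancel_left_pos times_divide_eq_right)
  \<comment> \<open>Numerators grow because \<open>p * q(E)\<close> is the null probability of
    \<open>E \<inter> \<Omega>\<close>; the denominator shrinks by \<open>q_H\<close>.\<close>
  also have "\<dots> \<le> measure_pmf.prob I {x. T x = 1} + measure_pmf.prob I (H S \<inter> {x. T x = 0}) / measure_pmf.prob I (H S)"
  proof (intro add_mono frac_le)
    show "p * measure_pmf.prob q {x. T x = 1} \<le> measure_pmf.prob I {x. T x = 1}"
      "p * measure_pmf.prob q (H S \<inter> {x. T x = 0}) \<le> measure_pmf.prob I (H S \<inter> {x. T x = 0})"
      using p_pos by (auto simp: q_eq intro!: measure_pmf.finite_measure_mono)
  qed (use H_pos[OF S] q_H[OF S] in auto)
  also have "\<dots> \<le> risk n \<beta> Q \<C> A T"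
    unfolding I_def H_def using S \<C> \<open>0 < A\<close> by (intro risk_ge_all_ones) auto
  finally show ?thesis by (simp add: p_def I_def)
qed

section \<open>Asymptotics in \<open>n\<close>\<close>

text \<open>The bound on \<open>s\<close> gives \<open>2 ^ s \<le> n powr (C / 2)\<close>, while
  \<open>N\<close> is at least \<open>n powr C\<close>.\<close>

lemma two_power_div_card_le:
  assumes "2 \<le> n" "0 < C" "C * ln (real n) \<le> ln (real N)" "real s \<le> C / (2 * ln 2) * ln (real n)"
  shows "2 ^ s / real N \<le> real n powr (- C / 2)"
proof -
  have "0 < C * ln (real n)" using assms by simp
  \<comment> \<open>As \<open>ln 0 = 0\<close>, a positive lower bound on the logarithm excludes
    \<open>N = 0\<close>.\<close>
  then have N: "real N > 0" using assms(3) by (cases "N = 0") auto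
  have "2 ^ s = exp (real s * ln 2)" by (simp add: exp_of_nat_mult)
  also have "\<dots> \<le> exp (C / 2 * ln (real n))" using assms(4) by (simp add: field_simps)
  finally have "2 ^ s / real N \<le> exp (C / 2 * ln (real n)) / exp (C * ln (real n))"
    using assms(3) N by (intro frac_le) (auto simp: ln_ge_iff)
  also have "\<dots> = real n powr (- C / 2)"
    using assms(1) by (simp add: powr_def exp_diff[symmetric] algebra_simps)
  finally show ?thesis .
qed

text \<open>Serves both parts of the theorem: all error terms are gathered in one null sequence
  \<open>r\<close>, and only the probability of \<open>\<Omega> n\<close> distinguishes the two
  conclusions.\<close>

lemma risk_asymptotic_lower_bound:
  fixes \<beta> :: "nat \<Rightarrow> real" and Q :: "nat \<Rightarrow> nat \<Rightarrow> nat \<Rightarrow> real"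
    and \<C> \<C>' :: "nat \<Rightarrow> nat set set"
  assumes ferro: "\<And>n i j. i \<in> {1..n} \<Longrightarrow> j \<in> {1..n} \<Longrightarrow> 0 \<le> \<beta> n * Q n i j"
    and "0 < C"
    and \<C>: "\<And>n S. 1 \<le> n \<Longrightarrow> S \<in> \<C> n \<Longrightarrow> S \<subseteq> {1..n} \<and> card S = s n"
    and \<C>': "\<And>n. 1 \<le> n \<Longrightarrow> \<C>' n \<subseteq> \<C> n"
    and card: "\<forall>\<^sub>F n in sequentially. C * ln (real n) \<le> ln (real (card (\<C>' n)))"
    and s: "\<forall>\<^sub>F n in sequentially. real (s n) \<le> C / (2 * ln 2) * ln (real n)"
    and \<Omega>: "\<And>n. 1 \<le> n \<Longrightarrow> increasing_spins n (\<Omega> n)" "\<forall>\<^sub>F n in sequentially. \<Omega> n \<noteq> {}"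
    and lim: "(\<lambda>n. SUP (S\<^sub>1, S\<^sub>2)\<in>{(S\<^sub>1, S\<^sub>2). S\<^sub>1 \<in> \<C>' n \<and> S\<^sub>2 \<in> \<C>' n \<and> S\<^sub>1 \<noteq> S\<^sub>2}.
          \<bar>\<P>(x in ising n (\<beta> n) (Q n) (\<lambda>_. 0). all_ones S\<^sub>1 x \<and> all_ones S\<^sub>2 x \<bar> x \<in> \<Omega> n) /
            (\<P>(x in ising n (\<beta> n) (Q n) (\<lambda>_. 0). all_ones S\<^sub>1 x \<bar> x \<in> \<Omega> n) *
             \<P>(x in ising n (\<beta> n) (Q n) (\<lambda>_. 0). all_ones S\<^sub>2 x \<bar> x \<in> \<Omega> n)) - 1\<bar>) \<longlonglongrightarrow> 0"
    and A: "\<And>n. 1 \<le> n \<Longrightarrow> 0 < A n" and T: "\<And>n. 1 \<le> n \<Longrightarrow> is_test n (T n)"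
  obtains r where "r \<longlonglongrightarrow> 0"
    "\<forall>\<^sub>F n in sequentially. \<P>(x in ising n (\<beta> n) (Q n) (\<lambda>_. 0). x \<in> \<Omega> n) * (1 - r n)
      \<le> risk n (\<beta> n) (Q n) (\<C> n) (A n) (T n)"
proof -
  define F where "F n S S' =
    \<bar>\<P>(x in ising n (\<beta> n) (Q n) (\<lambda>_. 0). all_ones S x \<and> all_ones S' x \<bar> x \<in> \<Omega> n) /
      (\<P>(x in ising n (\<beta> n) (Q n) (\<lambda>_. 0). all_ones S x \<bar> x \<in> \<Omega> n) *
       \<P>(x in ising n (\<beta> n) (Q n) (\<lambda>_. 0). all_ones S' x \<bar> x \<in> \<Omega> n)) - 1\<bar>" for n S S'
  define J where "J n = {(S\<^sub>1, S\<^sub>2). S\<^sub>1 \<in> \<C>' n \<and> S\<^sub>2 \<in> \<C>' n \<and> S\<^sub>1 \<noteq> S\<^sub>2}" for n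
  define D where "D n = (SUP (S, S')\<in>J n. F n S S')" for n
  \<comment> \<open>The absolute value supplies the nonnegative \<open>\<epsilon>\<close> of the
    fixed-\<open>n\<close> bound directly and still tends to 0.\<close>
  define r where "r n = sqrt (\<bar>D n\<bar> + real n powr (- C / 2))" for n
  have "(\<lambda>n. \<bar>D n\<bar>) \<longlonglongrightarrow> 0"
    using lim unfolding F_def[symmetric] J_def[symmetric] D_def[symmetric] by (rule tendsto_rabs_zero)
  moreover have "(\<lambda>n. real n powr (- C / 2)) \<longlonglongrightarrow> 0"
    using \<open>0 < C\<close> by (intro tendsto_neg_powr filterlim_real_sequentially) simp
  ultimately have "r \<longlonglongrightarrow> sqrt (0 + 0)"
    unfolding r_def by (intro tendsto_real_sqrt tendsto_add)
  then have r: "r \<longlonglongrightarrow> 0" by simp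
  have "\<forall>\<^sub>F n in sequentially. \<P>(x in ising n (\<beta> n) (Q n) (\<lambda>_. 0). x \<in> \<Omega> n) * (1 - r n)
      \<le> risk n (\<beta> n) (Q n) (\<C> n) (A n) (T n)"
    using card s \<Omega>(2) eventually_ge_at_top[of 2]
  proof eventually_elim
    case (elim n)
    have n: "1 \<le> n" using elim by simp
    have "0 < C * ln (real n)" using \<open>0 < C\<close> elim by simp
    then have "\<C>' n \<noteq> {}" using elim by auto
    have "finite (\<C>' n)"
      using \<C>[OF n] \<C>'[OF n] by (intro finite_subset[of "\<C>' n" "Pow {1..n}"]) auto
    then have "finite (J n)"
      by (intro finite_subset[of "J n" "\<C>' n \<times> \<C>' n"]) (auto simp: J_def)
    then have pair: "F n S S' \<le> \<bar>D n\<bar>" if "S \<in> \<C>' n" "S' \<in> \<C>' n" "S \<noteq> S'" for S S'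
    proof -
      have "(case (S, S') of (S, S') \<Rightarrow> F n S S') \<le> D n"
        unfolding D_def using \<open>finite (J n)\<close> that
        by (intro cSUP_upper bdd_above_finite finite_imageI) (auto simp: J_def)
      then show ?thesis by simp
    qed
    have "sqrt (\<bar>D n\<bar> + 2 ^ s n / real (card (\<C>' n))) \<le> r n"
      unfolding r_def using two_power_div_card_le[OF _ \<open>0 < C\<close>] elim by simp
    then have "\<P>(x in ising n (\<beta> n) (Q n) (\<lambda>_. 0). x \<in> \<Omega> n) * (1 - r n)
      \<le> \<P>(x in ising n (\<beta> n) (Q n) (\<lambda>_. 0). x \<in> \<Omega> n) * (1 - sqrt (\<bar>D n\<bar> + 2 ^ s n / real (card (\<C>' n))))"
      by (intro mult_left_mono) auto
    also have "\<dots> \<le> risk n (\<beta> n) (Q n) (\<C> n) (A n) (T n)"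
      using \<C>[OF n] \<C>'[OF n] \<open>\<C>' n \<noteq> {}\<close> elim n
      by (intro risk_lower_bound ferro \<Omega> A T pair[unfolded F_def]) auto
    finally show ?case .
  qed
  with r show ?thesis by (rule that)
qed

text \<open>Turns the unconditional hypothesis of part (I) into the conditional one with
  \<open>\<Omega> n = spins n\<close>.\<close>

lemma cond_prob_spins: "\<P>(x in ising n \<beta> Q \<mu>. R x \<bar> x \<in> spins n) = \<P>(x in ising n \<beta> Q \<mu>. R x)"
proof -
  have "spins n \<inter> {x. R x \<and> x \<in> spins n} = spins n \<inter> {x. R x}" by blast
  then show ?thesis by (simp add: cond_prob_def prob_spins) (simp add: measure_ising)
qed

section \<open>Absence of powerful tests for small \<open>s\<close>\<close>

theorem theorem4:
  fixes \<beta> :: "nat \<Rightarrow> real" and Q :: "nat \<Rightarrow> nat \<Rightarrow> nat \<Rightarrow> real" and C\<^sub>l :: real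
  assumes "\<And>n i j. i \<in> {1..n} \<Longrightarrow> j \<in> {1..n} \<Longrightarrow> Q n i j = Q n j i"
    and "\<And>n i. i \<in> {1..n} \<Longrightarrow> Q n i i = 0"
    and "\<And>n i j. i \<in> {1..n} \<Longrightarrow> j \<in> {1..n} \<Longrightarrow> 0 \<le> \<beta> n * Q n i j"
    and "C\<^sub>l > 0"
  shows "\<exists>c>0. \<forall>(s :: nat \<Rightarrow> nat) (\<C> :: nat \<Rightarrow> nat set set) (\<C>' :: nat \<Rightarrow> nat set set).
    (\<forall>n\<ge>1. s n \<in> {1..n}) \<longrightarrow>
    (\<forall>n\<ge>1. \<forall>S\<in>\<C> n. S \<subseteq> {1..n} \<and> card S = s n) \<longrightarrow>
    (\<forall>n\<ge>1. \<C>' n \<subseteq> \<C> n \<and> pairwise disjnt (\<C>' n)) \<longrightarrow>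
    (\<forall>\<^sub>F n in sequentially. ln (real (card (\<C>' n))) \<ge> C\<^sub>l * ln (real n)) \<longrightarrow>
    (\<forall>\<^sub>F n in sequentially. real (s n) \<le> c * ln (real n)) \<longrightarrow>
    ((\<lambda>n. SUP (S\<^sub>1, S\<^sub>2)\<in>{(S\<^sub>1, S\<^sub>2). S\<^sub>1 \<in> \<C>' n \<and> S\<^sub>2 \<in> \<C>' n \<and> S\<^sub>1 \<noteq> S\<^sub>2}.
        \<bar>\<P>(x in ising n (\<beta> n) (Q n) (\<lambda>_. 0). all_ones S\<^sub>1 x \<and> all_ones S\<^sub>2 x) /
          (\<P>(x in ising n (\<beta> n) (Q n) (\<lambda>_. 0). all_ones S\<^sub>1 x) *
           \<P>(x in ising n (\<beta> n) (Q n) (\<lambda>_. 0). all_ones S\<^sub>2 x)) - 1\<bar>) \<longlonglongrightarrow> 0 \<longrightarrow>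
      (\<forall>A T. (\<forall>n\<ge>1. A n > 0) \<longrightarrow> (\<forall>n\<ge>1. is_test n (T n)) \<longrightarrow> asymp_powerless \<beta> Q \<C> A T)) \<and>
    ((\<exists>(\<Omega> :: nat \<Rightarrow> (nat \<Rightarrow> real) set) \<kappa> :: real.
        (\<forall>n\<ge>1. increasing_spins n (\<Omega> n)) \<and> \<kappa> > 0 \<and>
        liminf (\<lambda>n. ereal \<P>(x in ising n (\<beta> n) (Q n) (\<lambda>_. 0). x \<in> \<Omega> n)) > ereal \<kappa> \<and>
        (\<lambda>n. SUP (S\<^sub>1, S\<^sub>2)\<in>{(S\<^sub>1, S\<^sub>2). S\<^sub>1 \<in> \<C>' n \<and> S\<^sub>2 \<in> \<C>' n \<and> S\<^sub>1 \<noteq> S\<^sub>2}.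
          \<bar>\<P>(x in ising n (\<beta> n) (Q n) (\<lambda>_. 0). all_ones S\<^sub>1 x \<and> all_ones S\<^sub>2 x \<bar> x \<in> \<Omega> n) /
            (\<P>(x in ising n (\<beta> n) (Q n) (\<lambda>_. 0). all_ones S\<^sub>1 x \<bar> x \<in> \<Omega> n) *
             \<P>(x in ising n (\<beta> n) (Q n) (\<lambda>_. 0). all_ones S\<^sub>2 x \<bar> x \<in> \<Omega> n)) - 1\<bar>) \<longlonglongrightarrow> 0) \<longrightarrow>
      (\<forall>A T. (\<forall>n\<ge>1. A n > 0) \<longrightarrow> (\<forall>n\<ge>1. is_test n (T n)) \<longrightarrow> \<not> asymp_powerful \<beta> Q \<C> A T))"
\<comment> \<open>With this constant \<open>2 ^ s n\<close> is eventually at most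
  \<open>n powr (C\<^sub>l / 2)\<close>, hence at most the square root of the size of
  \<open>\<C>' n\<close>.\<close>
proof (intro exI[of _ "C\<^sub>l / (2 * ln 2)"] conjI allI impI)
  show "0 < C\<^sub>l / (2 * ln 2)" using assms(4) by simp
next
  fix s :: "nat \<Rightarrow> nat" and \<C> \<C>' :: "nat \<Rightarrow> nat set set" and A :: "nat \<Rightarrow> real" and T
  assume \<C>: "\<forall>n\<ge>1. \<forall>S\<in>\<C> n. S \<subseteq> {1..n} \<and> card S = s n"
    and \<C>': "\<forall>n\<ge>1. \<C>' n \<subseteq> \<C> n \<and> pairwise disjnt (\<C>' n)"
    and card: "\<forall>\<^sub>F n in sequentially. C\<^sub>l * ln (real n) \<le> ln (real (card (\<C>' n)))"
    and s: "\<forall>\<^sub>F n in sequentially. real (s n) \<le> C\<^sub>l / (2 * ln 2) * ln (real n)"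
    and A: "\<forall>n\<ge>1. 0 < A n" and T: "\<forall>n\<ge>1. is_test n (T n)"
  note bound = risk_asymptotic_lower_bound[OF assms(3,4) \<C>[rule_format] _ card s _ _ _ A[rule_format] T[rule_format]]
  {
    assume lim: "(\<lambda>n. SUP (S\<^sub>1, S\<^sub>2)\<in>{(S\<^sub>1, S\<^sub>2). S\<^sub>1 \<in> \<C>' n \<and> S\<^sub>2 \<in> \<C>' n \<and> S\<^sub>1 \<noteq> S\<^sub>2}.
        \<bar>\<P>(x in ising n (\<beta> n) (Q n) (\<lambda>_. 0). all_ones S\<^sub>1 x \<and> all_ones S\<^sub>2 x) /
          (\<P>(x in ising n (\<beta> n) (Q n) (\<lambda>_. 0). all_ones S\<^sub>1 x) *
           \<P>(x in ising n (\<beta> n) (Q n) (\<lambda>_. 0). all_ones S\<^sub>2 x)) - 1\<bar>) \<longlonglongrightarrow> 0"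
    obtain r where r: "r \<longlonglongrightarrow> 0" and ev: "\<forall>\<^sub>F n in sequentially.
        \<P>(x in ising n (\<beta> n) (Q n) (\<lambda>_. 0). x \<in> spins n) * (1 - r n)
          \<le> risk n (\<beta> n) (Q n) (\<C> n) (A n) (T n)"
    proof (rule bound[where \<Omega> = spins])
      show "increasing_spins n (spins n)" for n by (simp add: increasing_spins_def)
      show "\<forall>\<^sub>F n in sequentially. spins n \<noteq> {}" by (simp add: spins_nonempty)
    qed (use \<C>' lim in \<open>auto simp: cond_prob_spins\<close>)
    \<comment> \<open>The whole space has probability 1, so the risk is eventually at least
      \<open>1 - r n\<close>.\<close>
    have "(\<lambda>n. ereal (1 - r n)) \<longlonglongrightarrow> ereal (1 - 0)"
      using r by (intro tendsto_intros)
    then have "liminf (\<lambda>n. ereal (1 - r n)) = ereal (1 - 0)"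
      by (intro lim_imp_Liminf) simp
    then have "1 = liminf (\<lambda>n. ereal (1 - r n))"
      by (simp add: one_ereal_def)
    also have "\<dots> \<le> liminf (\<lambda>n. ereal (risk n (\<beta> n) (Q n) (\<C> n) (A n) (T n)))"
      using ev by (intro Liminf_mono) (simp add: prob_spins)
    finally show "asymp_powerless \<beta> Q \<C> A T"
      by (simp add: asymp_powerless_def)
  next
    assume "\<exists>(\<Omega> :: nat \<Rightarrow> (nat \<Rightarrow> real) set) \<kappa> :: real.
        (\<forall>n\<ge>1. increasing_spins n (\<Omega> n)) \<and> \<kappa> > 0 \<and>
        liminf (\<lambda>n. ereal \<P>(x in ising n (\<beta> n) (Q n) (\<lambda>_. 0). x \<in> \<Omega> n)) > ereal \<kappa> \<and>
        (\<lambda>n. SUP (S\<^sub>1, S\<^sub>2)\<in>{(S\<^sub>1, S\<^sub>2). S\<^sub>1 \<in> \<C>' n \<and> S\<^sub>2 \<in> \<C>' n \<and> S\<^sub>1 \<noteq> S\<^sub>2}.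
          \<bar>\<P>(x in ising n (\<beta> n) (Q n) (\<lambda>_. 0). all_ones S\<^sub>1 x \<and> all_ones S\<^sub>2 x \<bar> x \<in> \<Omega> n) /
            (\<P>(x in ising n (\<beta> n) (Q n) (\<lambda>_. 0). all_ones S\<^sub>1 x \<bar> x \<in> \<Omega> n) *
             \<P>(x in ising n (\<beta> n) (Q n) (\<lambda>_. 0). all_ones S\<^sub>2 x \<bar> x \<in> \<Omega> n)) - 1\<bar>) \<longlonglongrightarrow> 0"
    then obtain \<Omega> :: "nat \<Rightarrow> (nat \<Rightarrow> real) set" and \<kappa> :: real where
      \<Omega>: "\<forall>n\<ge>1. increasing_spins n (\<Omega> n)" and \<kappa>: "\<kappa> > 0"
      and liminf: "liminf (\<lambda>n. ereal \<P>(x in ising n (\<beta> n) (Q n) (\<lambda>_. 0). x \<in> \<Omega> n)) > ereal \<kappa>"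
      and lim: "(\<lambda>n. SUP (S\<^sub>1, S\<^sub>2)\<in>{(S\<^sub>1, S\<^sub>2). S\<^sub>1 \<in> \<C>' n \<and> S\<^sub>2 \<in> \<C>' n \<and> S\<^sub>1 \<noteq> S\<^sub>2}.
          \<bar>\<P>(x in ising n (\<beta> n) (Q n) (\<lambda>_. 0). all_ones S\<^sub>1 x \<and> all_ones S\<^sub>2 x \<bar> x \<in> \<Omega> n) /
            (\<P>(x in ising n (\<beta> n) (Q n) (\<lambda>_. 0). all_ones S\<^sub>1 x \<bar> x \<in> \<Omega> n) *
             \<P>(x in ising n (\<beta> n) (Q n) (\<lambda>_. 0). all_ones S\<^sub>2 x \<bar> x \<in> \<Omega> n)) - 1\<bar>) \<longlonglongrightarrow> 0"
      by blast
    have prob_\<Omega>: "\<forall>\<^sub>F n in sequentially. \<kappa> < \<P>(x in ising n (\<beta> n) (Q n) (\<lambda>_. 0). x \<in> \<Omega> n)"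
      using less_LiminfD[OF liminf] by simp
    obtain r where r: "r \<longlonglongrightarrow> 0" and ev: "\<forall>\<^sub>F n in sequentially.
        \<P>(x in ising n (\<beta> n) (Q n) (\<lambda>_. 0). x \<in> \<Omega> n) * (1 - r n)
          \<le> risk n (\<beta> n) (Q n) (\<C> n) (A n) (T n)"
    proof (rule bound[where \<Omega> = \<Omega>])
      show "\<forall>\<^sub>F n in sequentially. \<Omega> n \<noteq> {}"
        using prob_\<Omega> by (rule eventually_mono) (use \<kappa> in auto)
    qed (use \<C>' \<Omega> lim in auto)
    \<comment> \<open>Any threshold below 1 would do; this one keeps the risk eventually above
      \<open>\<kappa> / 2\<close>, away from 0.\<close>
    have "\<forall>\<^sub>F n in sequentially. r n < 1 / 2"
      using r by (rule order_tendstoD) simp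
    then have "\<forall>\<^sub>F n in sequentially. ereal (\<kappa> / 2) \<le> ereal (risk n (\<beta> n) (Q n) (\<C> n) (A n) (T n))"
      using ev prob_\<Omega>
    proof eventually_elim
      case (elim n)
      have "\<kappa> * (1 / 2) \<le> \<P>(x in ising n (\<beta> n) (Q n) (\<lambda>_. 0). x \<in> \<Omega> n) * (1 - r n)"
        using elim \<kappa> by (intro mult_mono) auto
      with elim show ?case by simp
    qed
    then have "ereal (\<kappa> / 2) \<le> limsup (\<lambda>n. ereal (risk n (\<beta> n) (Q n) (\<C> n) (A n) (T n)))"
      by (intro le_Limsup) auto
    then show "\<not> asymp_powerful \<beta> Q \<C> A T"
      using \<kappa> by (auto simp: asymp_powerful_def zero_ereal_def)
  }
qed

end
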